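(* For every natural number $n$, the sum of the digits of $n$ in Zeckendorf representation is at most the sum of the digits of $n$ in canonical base-$\varphi$ representation.
   Context: Let $\varphi=(1+\sqrt5)/2$. The Fibonacci numbers are $F_0=0$, $F_1=1$, $F_n=F_{n-1}+F_{n-2}$. The Zeckendorf representation of an integer $n\ge 0$ is the unique representation $n=\sum_{2\le i\le t}a_iF_i$ with $a_i\in\{0,1\}$ and $a_ia_{i+1}\ne 1$ for all $i$; its sum of digits is $\sum_i a_i$. The canonical base-$\varphi$ representation of an integer $n\ge 0$ is the unique finite representation $n=\sum_{L\le i\le R}d_i\varphi^i$ ($L,R$ integers, possibly negative) with $d_i\in\{0,1\}$ and $d_id_{i+1}\neq 1$ for all $i$ (such a representation exists for every natural number, and is unique up to leading and trailing zeros); its sum of digits is $\sum_{L\le i\le R}d_i$. *)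

theory Defs
  imports Complex_Main "HOL-Number_Theory.Fib"
begin

definition golden_ratio :: real where
  "golden_ratio = (1 + sqrt 5) / 2"

(* A representation is a digit function, zero outside a finite set of positions. Extending by
   zero identifies representations that differ only in leading or trailing zeros. *)

definition zeckendorf_rep :: "nat \<Rightarrow> (nat \<Rightarrow> nat) \<Rightarrow> bool" where
  "zeckendorf_rep n a \<longleftrightarrow>
     finite {i. a i \<noteq> 0} \<and> (\<forall>i<2. a i = 0) \<and>
     (\<forall>i. a i \<in> {0, 1}) \<and> (\<forall>i. a i * a (i + 1) \<noteq> 1) \<and>
     n = (\<Sum>i | a i \<noteq> 0. a i * fib i)"

definition base_phi_rep :: "nat \<Rightarrow> (int \<Rightarrow> nat) \<Rightarrow> bool" where
  "base_phi_rep n d \<longleftrightarrow>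
     finite {i. d i \<noteq> 0} \<and>
     (\<forall>i. d i \<in> {0, 1}) \<and> (\<forall>i. d i * d (i + 1) \<noteq> 1) \<and>
     real n = (\<Sum>i | d i \<noteq> 0. real (d i) * golden_ratio powi i)"

(* The descriptions denote: see zeckendorf_rep_ex1 and base_phi_rep_ex1. *)

definition zeckendorf_digit :: "nat \<Rightarrow> nat \<Rightarrow> nat" where
  "zeckendorf_digit n = (THE a. zeckendorf_rep n a)"

definition base_phi_digit :: "nat \<Rightarrow> int \<Rightarrow> nat" where
  "base_phi_digit n = (THE d. base_phi_rep n d)"

definition zeckendorf_digit_sum :: "nat \<Rightarrow> nat" where
  "zeckendorf_digit_sum n = (\<Sum>i | zeckendorf_digit n i \<noteq> 0. zeckendorf_digit n i)"

definition base_phi_digit_sum :: "nat \<Rightarrow> nat" where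
  "base_phi_digit_sum n = (\<Sum>i | base_phi_digit n i \<noteq> 0. base_phi_digit n i)"


lemma dominated_sum_unique:
  fixes w :: "'i::linorder \<Rightarrow> real"
  assumes bound: "\<And>k U. \<lbrakk>finite U; P U; k \<in> I; U \<subseteq> {..<k}\<rbrakk> \<Longrightarrow> sum w U < w k"
    and sub: "\<And>U V. P U \<Longrightarrow> V \<subseteq> U \<Longrightarrow> P V"
    and PI: "\<And>U. P U \<Longrightarrow> U \<subseteq> I"
    and nonneg: "\<And>i. 0 \<le> w i"
    and ST: "finite S" "finite T" "P S" "P T" "sum w S = sum w T"
  shows "S = T"
proof (rule ccontr)
  have no_max: False
    if fin: "finite A" "finite B" and PA: "P A" and PB: "P B" and eq: "sum w A = sum w B"
      and m: "m \<in> A" "m \<notin> B" and top: "\<And>i. m < i \<Longrightarrow> i \<in> A \<longleftrightarrow> i \<in> B" for A B m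
  proof -
    have split: "sum w X = sum w (X \<inter> {..m}) + sum w (X \<inter> {m<..})" if "finite X" for X
    proof -
      have "X = (X \<inter> {..m}) \<union> (X \<inter> {m<..})" by auto
      thus ?thesis using that sum.union_disjoint [of "X \<inter> {..m}" "X \<inter> {m<..}" w] by fastforce
    qed
    have "A \<inter> {m<..} = B \<inter> {m<..}"
      using top by auto
    hence "sum w (A \<inter> {..m}) = sum w (B \<inter> {..m})"
      using split [OF fin(1)] split [OF fin(2)] eq by simp
    moreover have "w m \<le> sum w (A \<inter> {..m})"
      using fin m nonneg by (intro member_le_sum) auto
    moreover have "sum w (B \<inter> {..m}) < w m"
    proof (rule bound)
      show "P (B \<inter> {..m})" using sub [OF PB] by blast
      show "m \<in> I" using PI [OF PA] m by blast
      show "B \<inter> {..m} \<subseteq> {..<m}" using m(2) by (auto simp: order_le_less)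
    qed (use fin in auto)
    ultimately show False by simp
  qed
  assume "S \<noteq> T"
  define D where "D = (S - T) \<union> (T - S)"
  have D: "finite D" "D \<noteq> {}"
    using ST \<open>S \<noteq> T\<close> by (auto simp: D_def)
  define m where "m = Max D"
  have mD: "m \<in> D" and top: "\<And>i. m < i \<Longrightarrow> i \<notin> D"
    using D by (auto simp: m_def dest: Max_ge)
  show False
  proof (cases "m \<in> S")
    case True
    show False
      by (rule no_max [of S T m]) (use ST True mD top in \<open>auto simp: D_def\<close>)
  next
    case False
    show False
      by (rule no_max [of T S m]) (use ST False mD top in \<open>auto simp: D_def\<close>)
  qed
qed


lemma sum_fib_sparse_less:
  assumes "finite U" "\<forall>i\<in>U. 2 \<le> i \<and> i + 1 \<notin> U" "2 \<le> k" "U \<subseteq> {..<k}"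
  shows "sum fib U < fib k"
  using assms
proof (induction "card U" arbitrary: U k rule: less_induct)
  case less
  show ?case
  proof (cases "U = {}")
    case True
    thus ?thesis using less.prems by (simp add: fib_neq_0_nat)
  next
    case False
    define m where "m = Max U"
    have m: "m \<in> U" "\<And>i. i \<in> U \<Longrightarrow> i \<le> m" "2 \<le> m" "m < k"
      using False less.prems unfolding m_def by (auto intro: Max_in)
    show ?thesis
    proof (cases "U = {m}")
      case True
      have "fib m < fib (Suc m)"
        using m(3) by (cases m rule: fib.cases) (auto simp: fib_neq_0_nat)
      also have "\<dots> \<le> fib k"
        using m by (intro fib_mono) auto
      finally show ?thesis using True by simp
    next
      case False
      have lt: "i < m - 1" if "i \<in> U - {m}" for i
      proof -
        have "i < m" using m(2) [of i] that by auto
        moreover have "i + 1 \<noteq> m" using that m(1) less.prems(2) by auto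
        ultimately show ?thesis by simp
      qed
      obtain j where j: "j \<in> U - {m}" using False m by auto
      have "2 \<le> m - 1" using lt [OF j] j less.prems(2) by force
      have "sum fib (U - {m}) < fib (m - 1)"
      proof (rule less.hyps)
        show "card (U - {m}) < card U"
          using m less.prems by (intro psubset_card_mono) auto
      qed (use less.prems lt \<open>2 \<le> m - 1\<close> in auto)
      hence "sum fib U < fib m + fib (m - 1)"
        using m less.prems by (simp add: sum.remove)
      also have "\<dots> = fib (Suc m)"
        using m(3) by (cases m) auto
      also have "\<dots> \<le> fib k"
        using m by (intro fib_mono) auto
      finally show ?thesis .
    qed
  qed
qed

lemma zeckendorf_set_exists:
  "\<exists>S. finite S \<and> (\<forall>i\<in>S. 2 \<le> i \<and> i + 1 \<notin> S) \<and> sum fib S = n"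
proof (induction n rule: less_induct)
  case (less n)
  show ?case
  proof (cases "n = 0")
    case True
    thus ?thesis by (intro exI [of _ "{}"]) auto
  next
    case False
    have grow: "k \<le> fib (k + 2)" for k
    proof (induction k)
      case (Suc k)
      have "0 < fib (Suc k)" by (simp add: fib_neq_0_nat)
      thus ?case using Suc by simp
    qed auto
    define Q where "Q k \<longleftrightarrow> n < fib (Suc k)" for k
    have ex: "Q (Suc (Suc n))"
      using grow [of "Suc n"] by (simp add: Q_def)
    define k where "k = (LEAST k. Q k)"
    have Qk: "n < fib (Suc k)"
      using LeastI [of Q, OF ex] by (simp add: k_def Q_def)
    have k2: "2 \<le> k"
    proof (rule ccontr)
      assume "\<not> 2 \<le> k"
      hence "k = 0 \<or> k = 1" by auto
      thus False using Qk False by auto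
    qed
    have kn: "fib k \<le> n"
    proof -
      have "\<not> Q (k - 1)" using k2 not_less_Least [of "k - 1" Q] by (simp add: k_def)
      thus ?thesis using k2 by (simp add: Q_def)
    qed
    have "0 < fib k" using k2 by (simp add: fib_neq_0_nat)
    hence "n - fib k < n" using False by simp
    then obtain S where S: "finite S" "\<forall>i\<in>S. 2 \<le> i \<and> i + 1 \<notin> S" "sum fib S = n - fib k"
      using less.IH by blast
    have lt: "i < k - 1" if "i \<in> S" for i
    proof -
      have "fib i \<le> sum fib S" using S that by (intro member_le_sum) auto
      also have "\<dots> < fib (k - 1)"
        using S(3) Qk kn k2 by (cases k) auto
      finally have "fib i < fib (k - 1)" .
      thus ?thesis using fib_mono [of "k - 1" i] by (meson not_less)
    qed
    have "k \<notin> S" using lt by fastforce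
    hence "sum fib (insert k S) = n" using S kn by simp
    moreover have "\<forall>i\<in>insert k S. 2 \<le> i \<and> i + 1 \<notin> insert k S"
    proof
      fix i assume i: "i \<in> insert k S"
      have "k + 1 \<notin> S" using lt [of "k + 1"] by auto
      moreover have "i + 1 \<noteq> k" if "i \<in> S" using lt [OF that] by auto
      ultimately show "2 \<le> i \<and> i + 1 \<notin> insert k S" using i S(2) k2 by auto
    qed
    ultimately show ?thesis using S(1) by (intro exI [of _ "insert k S"]) auto
  qed
qed

lemma zeckendorf_rep_support:
  assumes "zeckendorf_rep n a"
  defines "S \<equiv> {i. a i \<noteq> 0}"
  shows "finite S" "\<forall>i\<in>S. 2 \<le> i \<and> i + 1 \<notin> S" "sum fib S = n" "a = (\<lambda>i. of_bool (i \<in> S))"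
proof -
  have digit: "a i \<in> {0, 1}" for i
    using assms(1) unfolding zeckendorf_rep_def by blast
  have a: "a i = of_bool (i \<in> S)" for i
    using digit [of i] by (auto simp: S_def)
  show "a = (\<lambda>i. of_bool (i \<in> S))" using a by auto
  show "finite S" using assms by (simp add: zeckendorf_rep_def)
  have adj: "a i * a (i + 1) \<noteq> 1" and small: "i < 2 \<Longrightarrow> a i = 0" for i
    using assms(1) unfolding zeckendorf_rep_def by blast+
  show "\<forall>i\<in>S. 2 \<le> i \<and> i + 1 \<notin> S"
  proof
    fix i assume "i \<in> S"
    thus "2 \<le> i \<and> i + 1 \<notin> S"
      using adj [of i] small [of i] a [of i] a [of "i + 1"] by (cases "i + 1 \<in> S"; cases "i < 2") auto
  qed
  have "n = (\<Sum>i\<in>S. a i * fib i)"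
    using assms by (simp add: zeckendorf_rep_def)
  also have "\<dots> = sum fib S" by (intro sum.cong) (auto simp: a)
  finally show "sum fib S = n" ..
qed

lemma zeckendorf_rep_ex1: "\<exists>!a. zeckendorf_rep n a"
proof (rule ex_ex1I)
  obtain S where S: "finite S" "\<forall>i\<in>S. 2 \<le> i \<and> i + 1 \<notin> S" "sum fib S = n"
    using zeckendorf_set_exists by blast
  have "zeckendorf_rep n (\<lambda>i. of_bool (i \<in> S))"
    using S by (fastforce simp: zeckendorf_rep_def)
  thus "\<exists>a. zeckendorf_rep n a" by blast
next
  fix a b assume a: "zeckendorf_rep n a" and b: "zeckendorf_rep n b"
  let ?P = "\<lambda>U :: nat set. \<forall>i\<in>U. 2 \<le> i \<and> i + 1 \<notin> U"
  note A = zeckendorf_rep_support [OF a] and B = zeckendorf_rep_support [OF b]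
  have "{i. a i \<noteq> 0} = {i. b i \<noteq> 0}"
  proof (rule dominated_sum_unique [where w = "\<lambda>i. real (fib i)" and P = ?P and I = "{2..}"])
    fix k :: nat and U assume "finite U" "?P U" "k \<in> {2..}" "U \<subseteq> {..<k}"
    hence "sum fib U < fib k" by (intro sum_fib_sparse_less) auto
    thus "(\<Sum>i\<in>U. real (fib i)) < real (fib k)"
      by (simp flip: of_nat_sum)
  next
    show "(\<Sum>i | a i \<noteq> 0. real (fib i)) = (\<Sum>i | b i \<noteq> 0. real (fib i))"
      using A(3) B(3) by (simp flip: of_nat_sum)
  qed (use A(1,2) B(1,2) in auto)
  thus "a = b" using A(4) B(4) by metis
qed


lemma golden_ratio_gt_1: "1 < golden_ratio"
  by (simp add: golden_ratio_def)

lemma golden_ratio_pos: "0 < golden_ratio"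
  using golden_ratio_gt_1 by simp

lemma golden_ratio_square: "golden_ratio * golden_ratio = golden_ratio + 1"
  by (simp add: golden_ratio_def field_simps)

lemma golden_ratio_powi_add:
  "golden_ratio powi (i + 2) = golden_ratio powi (i + 1) + golden_ratio powi i"
  using golden_ratio_pos golden_ratio_square
  by (simp add: power_int_add power2_eq_square algebra_simps)

lemma golden_ratio_powi_double:
  "2 * golden_ratio powi i = golden_ratio powi (i + 1) + golden_ratio powi (i - 2)"
  using golden_ratio_powi_add [of "i - 1"] golden_ratio_powi_add [of "i - 2"] by (simp add: add.commute)

lemma sum_golden_ratio_sparse_less:
  assumes "finite U" "\<forall>i\<in>U. i + 1 \<notin> U" "U \<subseteq> {..<k}"
  shows "(\<Sum>i\<in>U. golden_ratio powi i) < golden_ratio powi k"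
  using assms
proof (induction "card U" arbitrary: U k rule: less_induct)
  case less
  show ?case
  proof (cases "U = {}")
    case True
    thus ?thesis using golden_ratio_pos by simp
  next
    case False
    define m where "m = Max U"
    have m: "m \<in> U" "\<And>i. i \<in> U \<Longrightarrow> i \<le> m" "m < k"
      using False less.prems unfolding m_def by (auto intro: Max_in)
    have "(\<Sum>i\<in>U - {m}. golden_ratio powi i) < golden_ratio powi (m - 1)"
    proof (rule less.hyps)
      show "card (U - {m}) < card U"
        using m less.prems by (intro psubset_card_mono) auto
      show "U - {m} \<subseteq> {..<m - 1}"
      proof
        fix i assume i: "i \<in> U - {m}"
        have "i < m" using m(2) [of i] i by auto
        moreover have "i + 1 \<noteq> m" using i m(1) less.prems(2) by auto
        ultimately show "i \<in> {..<m - 1}" by simp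
      qed
    qed (use less.prems in auto)
    hence "(\<Sum>i\<in>U. golden_ratio powi i) < golden_ratio powi m + golden_ratio powi (m - 1)"
      using m less.prems by (simp add: sum.remove)
    also have "\<dots> = golden_ratio powi (m + 1)"
      using golden_ratio_powi_add [of "m - 1"] by (simp add: add.commute)
    also have "\<dots> \<le> golden_ratio powi k"
      using m golden_ratio_gt_1 by (intro power_int_increasing) auto
    finally show ?thesis .
  qed
qed

lemma golden_ratio_make_sparse:
  fixes S :: "int set"
  assumes "finite S"
  shows "\<exists>T. finite T \<and> (\<forall>i\<in>T. i + 1 \<notin> T) \<and>
    (\<Sum>i\<in>T. golden_ratio powi i) = (\<Sum>i\<in>S. golden_ratio powi i)"
  using assms
proof (induction "card S" arbitrary: S rule: less_induct)
  case less
  show ?case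
  proof (cases "\<forall>i\<in>S. i + 1 \<notin> S")
    case True
    thus ?thesis using less.prems by blast
  next
    case False
    define D where "D = {i \<in> S. i + 1 \<in> S}"
    have D: "finite D" "D \<noteq> {}" using False less.prems by (auto simp: D_def)
    define m where "m = Max D"
    have "m \<in> D" using D by (simp add: m_def)
    moreover have "m + 1 \<notin> D" using D Max_ge [of D "m + 1"] by (auto simp: m_def)
    ultimately have m: "m \<in> S" "m + 1 \<in> S" "m + 2 \<notin> S" by (auto simp: D_def add.assoc)
    define R where "R = S - {m} - {m + 1}"
    have R: "finite R" "m + 2 \<notin> R" "m \<notin> R" "m + 1 \<notin> R" "S = insert m (insert (m + 1) R)"
      using m less.prems by (auto simp: R_def)
    have "card (insert (m + 2) R) < card S" using R(1-4) by (subst R(5)) simp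
    then obtain T where T: "finite T" "\<forall>i\<in>T. i + 1 \<notin> T"
      "(\<Sum>i\<in>T. golden_ratio powi i) = (\<Sum>i\<in>insert (m + 2) R. golden_ratio powi i)"
      using less.hyps R(1) by (metis finite_insert)
    have "(\<Sum>i\<in>insert (m + 2) R. golden_ratio powi i) = (\<Sum>i\<in>S. golden_ratio powi i)"
      using R(1-4) golden_ratio_powi_add [of m] by (subst R(5)) simp
    thus ?thesis using T by auto
  qed
qed

lemma golden_ratio_add_power:
  fixes S :: "int set"
  assumes "finite S" "\<forall>i\<in>S. i \<le> k \<longrightarrow> i + 1 \<notin> S"
  shows "\<exists>T. finite T \<and>
    (\<Sum>i\<in>T. golden_ratio powi i) = (\<Sum>i\<in>S. golden_ratio powi i) + golden_ratio powi k"
  using assms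
proof (induction "card {i \<in> S. i \<le> k}" arbitrary: S k rule: less_induct)
  case less
  show ?case
  proof (cases "k \<in> S")
    case False
    thus ?thesis using less.prems by (intro exI [of _ "insert k S"]) auto
  next
    case True
    define R where "R = S - {k}"
    have R: "finite R" "k \<notin> R" "k + 1 \<notin> R" "S = insert k R"
      using True less.prems by (auto simp: R_def)
    define S' where "S' = insert (k + 1) R"
    have "{i \<in> S'. i \<le> k - 2} \<subset> {i \<in> S. i \<le> k}"
      using R by (auto simp: S'_def)
    hence "card {i \<in> S'. i \<le> k - 2} < card {i \<in> S. i \<le> k}"
      using less.prems by (intro psubset_card_mono) auto
    moreover have "finite S'" using R by (simp add: S'_def)
    moreover have "\<forall>i\<in>S'. i \<le> k - 2 \<longrightarrow> i + 1 \<notin> S'"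
      using less.prems(2) by (auto simp: S'_def R_def)
    ultimately obtain T where T: "finite T" "(\<Sum>i\<in>T. golden_ratio powi i) =
        (\<Sum>i\<in>S'. golden_ratio powi i) + golden_ratio powi (k - 2)"
      using less.hyps by blast
    have "(\<Sum>i\<in>S'. golden_ratio powi i) + golden_ratio powi (k - 2) =
        (\<Sum>i\<in>S. golden_ratio powi i) + golden_ratio powi k"
      using R(1-3) golden_ratio_powi_double [of k] by (subst R(4)) (simp add: S'_def)
    thus ?thesis using T by auto
  qed
qed

lemma base_phi_set_exists:
  "\<exists>S. finite S \<and> (\<forall>i\<in>S. i + 1 \<notin> S) \<and> (\<Sum>i\<in>S. golden_ratio powi i) = real n"
proof (induction n)
  case 0
  show ?case by (intro exI [of _ "{}"]) auto
next
  case (Suc n)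
  then obtain S where S: "finite S" "\<forall>i\<in>S. i + 1 \<notin> S"
    "(\<Sum>i\<in>S. golden_ratio powi i) = real n" by blast
  obtain T where T: "finite T" "(\<Sum>i\<in>T. golden_ratio powi i) = real n + golden_ratio powi 0"
    using golden_ratio_add_power [of S 0] S by auto
  show ?case using golden_ratio_make_sparse [OF T(1)] T(2) by (simp add: add.commute)
qed

lemma base_phi_rep_support:
  assumes "base_phi_rep n d"
  defines "S \<equiv> {i. d i \<noteq> 0}"
  shows "finite S" "\<forall>i\<in>S. i + 1 \<notin> S" "(\<Sum>i\<in>S. golden_ratio powi i) = real n"
    "d = (\<lambda>i. of_bool (i \<in> S))"
proof -
  have digit: "d i \<in> {0, 1}" for i
    using assms(1) unfolding base_phi_rep_def by blast
  have d: "d i = of_bool (i \<in> S)" for i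
    using digit [of i] by (auto simp: S_def)
  show "d = (\<lambda>i. of_bool (i \<in> S))" using d by auto
  show "finite S" using assms by (simp add: base_phi_rep_def)
  have adj: "d i * d (i + 1) \<noteq> 1" for i
    using assms(1) unfolding base_phi_rep_def by blast
  show "\<forall>i\<in>S. i + 1 \<notin> S"
  proof
    fix i assume "i \<in> S"
    thus "i + 1 \<notin> S"
      using adj [of i] d [of i] d [of "i + 1"] by (cases "i + 1 \<in> S") auto
  qed
  have "real n = (\<Sum>i\<in>S. real (d i) * golden_ratio powi i)"
    using assms by (simp add: base_phi_rep_def)
  also have "\<dots> = (\<Sum>i\<in>S. golden_ratio powi i)" by (intro sum.cong) (auto simp: d)
  finally show "(\<Sum>i\<in>S. golden_ratio powi i) = real n" ..
qed

lemma base_phi_rep_ex1: "\<exists>!d. base_phi_rep n d"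
proof (rule ex_ex1I)
  obtain S where S: "finite S" "\<forall>i\<in>S. i + 1 \<notin> S" "(\<Sum>i\<in>S. golden_ratio powi i) = real n"
    using base_phi_set_exists by blast
  have "base_phi_rep n (\<lambda>i. of_bool (i \<in> S))"
    using S by (auto simp: base_phi_rep_def)
  thus "\<exists>d. base_phi_rep n d" by blast
next
  fix a b assume a: "base_phi_rep n a" and b: "base_phi_rep n b"
  let ?P = "\<lambda>U::int set. \<forall>i\<in>U. i + 1 \<notin> U"
  note A = base_phi_rep_support [OF a] and B = base_phi_rep_support [OF b]
  have "{i. a i \<noteq> 0} = {i. b i \<noteq> 0}"
  proof (rule dominated_sum_unique [where w = "\<lambda>i. golden_ratio powi i" and P = ?P and I = UNIV])
    show "0 \<le> golden_ratio powi i" for i using golden_ratio_pos by simp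
  qed (use A(1-3) B(1-3) in \<open>auto intro: sum_golden_ratio_sparse_less\<close>)
  thus "a = b" using A(4) B(4) by metis
qed

lemma zeckendorf_rep_digit: "zeckendorf_rep n (zeckendorf_digit n)"
  unfolding zeckendorf_digit_def by (rule theI' [OF zeckendorf_rep_ex1])

lemma base_phi_rep_digit: "base_phi_rep n (base_phi_digit n)"
  unfolding base_phi_digit_def by (rule theI' [OF base_phi_rep_ex1])

end

theory Submission
  imports Defs "HOL-Library.Multiset"
begin

text \<open>
  Write \<open>Z n\<close> for the Zeckendorf digit sum, \<open>\<phi>\<close> for the golden ratio and \<open>L k\<close> for the Lucas
  numbers. Two facts are played against each other. First, no way of writing \<open>n\<close> as a sum of
  Fibonacci numbers uses fewer summands than Zeckendorf's, so \<open>Z (m + n) \<le> Z m + Z n\<close>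
  (\<open>zeckendorf_digit_sum_add_le\<close>). Second, \<open>L k = \<phi>^k + (-1)^k \<phi>^(-k)\<close>, and so adding a suitable Lucas
  number to \<open>N\<close> changes the base-\<open>\<phi>\<close> expansion of \<open>N\<close> only at its two ends. This generates all
  expansions recursively, from one interval between consecutive Lucas numbers to the next:

  \<^item> from \<open>N \<le> L (2n+1)\<close> to \<open>N + L (2n+2)\<close>, with two new digits;
  \<^item> from \<open>L (2n) \<le> N \<le> L (2n+1)\<close> to \<open>N + L (2n+3)\<close>, with two new digits;
  \<^item> from \<open>L (2n+1) < N < L (2n+2)\<close> to both \<open>N + L (2n+2)\<close> and \<open>N + L (2n+3)\<close>, with one new digit.

  As \<open>Z (L k) \<le> 2\<close>, the steps that create two digits preserve \<open>Z N \<le> digit sum of N\<close> by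
  subadditivity. The steps of the last kind create only one digit, and for them the inequality has to be
  strengthened. The strengthening rests on the fact that a \<^emph>\<open>ladder\<close>
  \<open>L b + L (b+2) + ... + L (b + 2(a-1))\<close> of \<open>a\<close> Lucas numbers is a sum of at most \<open>a + 1\<close> Fibonacci numbers
  (\<open>zeckendorf_digit_sum_lucas_ladder\<close>), where subadditivity alone gives \<open>2 a\<close>. The invariant
  (\<open>ladder_bound\<close>) is that \<open>N\<close>, lying strictly between \<open>L (2n+1)\<close> and \<open>L (2n+2)\<close> for some \<open>n \<ge> 1\<close>,
  splits as a ladder of \<open>a + 1\<close> rungs with top rung \<open>L (2n+1)\<close> plus a rest \<open>X\<close>, and that
  the base-\<open>\<phi>\<close> expansion has enough digits to pay for the ladder and for \<open>Z X\<close>. Adding \<open>L (2n+3)\<close> puts one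
  more rung on the ladder, for one more digit. Adding \<open>L (2n+2)\<close> merges with the top rung into
  \<open>L (2n+3)\<close>, which starts a new ladder, while the other \<open>a\<close> rungs fall into the rest at the price of
  \<open>a + 1\<close> digits; removing them from the ladder has released \<open>a\<close>, and the new digit pays the difference.
\<close>

section \<open>Fewest Fibonacci summands\<close>

text \<open>
  Two rewriting steps bring a multiset of Fibonacci indices into Zeckendorf form without making it
  larger: \<open>F i + F (i+1) = F (i+2)\<close> and \<open>2 F i = F (i+1) + F (i-2)\<close>, the latter degenerating to
  \<open>2 F 3 = F 4 + F 2\<close> and \<open>2 F 2 = F 3\<close>. The weight is chosen so that each of them lowers the total. The
  plain weight \<open>i + 2\<close> fails for \<open>2 F 3 = F 4 + F 2\<close>, where the index sum stays at 6; hence the exception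
  at 2.
\<close>

definition index_weight :: "nat \<Rightarrow> nat" where
  "index_weight i = (if i = 2 then 3 else i + 2)"

lemma fib_multiset_make_sparse:
  assumes "\<forall>i\<in>#M. 2 \<le> i"
  shows "\<exists>S. finite S \<and> (\<forall>i\<in>S. 2 \<le> i \<and> i + 1 \<notin> S) \<and>
    sum fib S = (\<Sum>i\<in>#M. fib i) \<and> card S \<le> size M"
  using assms
proof (induction "\<Sum>i\<in>#M. index_weight i" arbitrary: M rule: less_induct)
  case less
  have replace: ?case
    if M: "M = R + A" and B: "\<forall>i\<in>#B. 2 \<le> i" "size B \<le> size A"
      "(\<Sum>i\<in>#B. fib i) = (\<Sum>i\<in>#A. fib i)"
      "(\<Sum>i\<in>#B. index_weight i) < (\<Sum>i\<in>#A. index_weight i)" for R A B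
  proof -
    have "\<exists>S. finite S \<and> (\<forall>i\<in>S. 2 \<le> i \<and> i + 1 \<notin> S) \<and>
        sum fib S = (\<Sum>i\<in>#R + B. fib i) \<and> card S \<le> size (R + B)"
      by (rule less.hyps) (use less.prems M B in auto)
    then obtain S where "finite S" "\<forall>i\<in>S. 2 \<le> i \<and> i + 1 \<notin> S"
      "sum fib S = (\<Sum>i\<in>#R + B. fib i)" "card S \<le> size (R + B)" by blast
    thus ?thesis using M B(2,3) by (intro exI [of _ S]) auto
  qed
  \<comment> \<open>A multiset to which no step applies is the Zeckendorf set that is sought.\<close>
  consider (dup) i where "2 \<le> count M i" | (adj) i where "i \<in># M" "i + 1 \<in># M"
    | (sparse) "\<forall>i. \<not> 2 \<le> count M i" "\<forall>i\<in>#M. i + 1 \<notin># M"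
    by blast
  thus ?case
  proof cases
    case (dup i)
    have "replicate_mset 2 i \<subseteq># M"
      using dup by (simp add: count_le_replicate_mset_subset_eq)
    hence "{#i, i#} \<subseteq># M" by (simp add: numeral_2_eq_2)
    hence M: "M = (M - {#i, i#}) + {#i, i#}"
      by (rule subset_mset.diff_add [symmetric])
    have "0 < count M i" using dup by linarith
    hence "2 \<le> i" using less.prems by simp
    then consider "i = 2" | "i = 3" | "4 \<le> i"
      by linarith
    thus ?thesis
    proof cases
      case 1
      show ?thesis
        by (rule replace [OF M, of "{#3#}"])
          (simp_all add: 1 index_weight_def numeral_eq_Suc)
    next
      case 2
      show ?thesis
        by (rule replace [OF M, of "{#4, 2#}"])
          (simp_all add: 2 index_weight_def numeral_eq_Suc)
    next
      case 3
      define k where "k = i - 4"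
      have "i = k + 4" using 3 by (simp add: k_def)
      thus ?thesis
        by (intro replace [OF M, of "{#k + 5, k + 2#}"])
          (simp_all add: index_weight_def numeral_eq_Suc)
    qed
  next
    case (adj i)
    have "{#i, i + 1#} \<subseteq># M"
      using adj by (simp add: insert_subset_eq_iff in_diff_count)
    hence M: "M = (M - {#i, i + 1#}) + {#i, i + 1#}"
      by (rule subset_mset.diff_add [symmetric])
    have "2 \<le> i" using adj less.prems by blast
    thus ?thesis
      by (intro replace [OF M, of "{#i + 2#}"]) (simp_all add: index_weight_def)
  next
    case sparse
    have M: "mset_set (set_mset M) = M"
    proof (rule multiset_eqI)
      fix i
      have "count M i < 2" using sparse(1) by (simp add: not_le)
      thus "count (mset_set (set_mset M)) i = count M i"
        by (auto simp add: count_mset_set' simp flip: count_greater_zero_iff)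
    qed
    have "sum fib (set_mset M) = (\<Sum>i\<in>#M. fib i)"
      by (simp only: sum_unfold_sum_mset M)
    moreover have "card (set_mset M) = size M"
      using size_mset_set [of "set_mset M"] by (simp only: M)
    ultimately show ?thesis
      using sparse(2) less.prems by (intro exI [of _ "set_mset M"]) simp
  qed
qed

lemma zeckendorf_digit_sum_eq_card:
  assumes "finite S" "\<forall>i\<in>S. 2 \<le> i \<and> i + 1 \<notin> S" "sum fib S = n"
  shows "zeckendorf_digit_sum n = card S"
proof -
  have "zeckendorf_rep n (\<lambda>i. of_bool (i \<in> S))"
    using assms by (fastforce simp: zeckendorf_rep_def)
  hence "zeckendorf_digit n = (\<lambda>i. of_bool (i \<in> S))"
    using zeckendorf_rep_ex1 zeckendorf_rep_digit by blast
  thus ?thesis by (simp add: zeckendorf_digit_sum_def)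
qed

text \<open>Normalising \<open>M\<close> never adds summands and must end at the unique Zeckendorf representation.\<close>

lemma zeckendorf_digit_sum_minimal:
  assumes "\<forall>i\<in>#M. 2 \<le> i"
  shows "zeckendorf_digit_sum (\<Sum>i\<in>#M. fib i) \<le> size M"
proof -
  obtain S where "finite S" "\<forall>i\<in>S. 2 \<le> i \<and> i + 1 \<notin> S"
    "sum fib S = (\<Sum>i\<in>#M. fib i)" "card S \<le> size M"
    using fib_multiset_make_sparse [OF assms] by blast
  thus ?thesis using zeckendorf_digit_sum_eq_card [of S] by simp
qed

lemma zeckendorf_multiset_exists:
  "\<exists>M. (\<forall>i\<in>#M. 2 \<le> i) \<and> (\<Sum>i\<in>#M. fib i) = n \<and> size M = zeckendorf_digit_sum n"
proof -
  obtain S where S: "finite S" "\<forall>i\<in>S. 2 \<le> i \<and> i + 1 \<notin> S" "sum fib S = n"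
    using zeckendorf_set_exists [of n] by (elim exE conjE)
  have "(\<Sum>i\<in>#mset_set S. fib i) = n"
    using S(3) by (simp only: sum_unfold_sum_mset)
  moreover have "size (mset_set S) = zeckendorf_digit_sum n"
    using zeckendorf_digit_sum_eq_card [OF S] by simp
  moreover have "\<forall>i\<in>#mset_set S. 2 \<le> i" using S(1,2) by simp
  ultimately show ?thesis by (intro exI conjI)
qed

lemma zeckendorf_digit_sum_add_le:
  "zeckendorf_digit_sum (m + n) \<le> zeckendorf_digit_sum m + zeckendorf_digit_sum n"
proof -
  obtain M where M: "\<forall>i\<in>#M. 2 \<le> i" "(\<Sum>i\<in>#M. fib i) = m" "size M = zeckendorf_digit_sum m"
    using zeckendorf_multiset_exists by blast
  obtain N where N: "\<forall>i\<in>#N. 2 \<le> i" "(\<Sum>i\<in>#N. fib i) = n" "size N = zeckendorf_digit_sum n"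
    using zeckendorf_multiset_exists by blast
  show ?thesis
    using zeckendorf_digit_sum_minimal [of "M + N"] M N by auto
qed

lemma zeckendorf_digit_sum_0: "zeckendorf_digit_sum 0 = 0"
  using zeckendorf_digit_sum_minimal [of "{#}"] by simp

lemma zeckendorf_digit_sum_fib: "zeckendorf_digit_sum (fib i) \<le> 1"
proof -
  consider "i = 0" | "i = 1" | "2 \<le> i" by linarith
  thus ?thesis
  proof cases
    case 2
    thus ?thesis using zeckendorf_digit_sum_minimal [of "{#2#}"] by (simp add: numeral_2_eq_2)
  next
    case 3
    thus ?thesis using zeckendorf_digit_sum_minimal [of "{#i#}"] by simp
  qed (simp add: zeckendorf_digit_sum_0)
qed

section \<open>Lucas numbers\<close>

fun lucas :: "nat \<Rightarrow> nat" where
  "lucas 0 = 2"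
| "lucas (Suc 0) = 1"
| "lucas (Suc (Suc n)) = lucas (Suc n) + lucas n"

declare lucas.simps(3) [simp del]

lemma lucas_eq_fib: "lucas (Suc n) = fib (n + 2) + fib n"
  by (induction n rule: lucas.induct) (auto simp: lucas.simps(3) numeral_2_eq_2)

lemma zeckendorf_digit_sum_lucas: "zeckendorf_digit_sum (lucas (Suc n)) \<le> 2"
  using zeckendorf_digit_sum_add_le [of "fib (n + 2)" "fib n"]
    zeckendorf_digit_sum_fib [of n] zeckendorf_digit_sum_fib [of "n + 2"]
  by (simp add: lucas_eq_fib)

text \<open>The exponents are variables so that the recurrence applies to exponents in any syntactic form.\<close>

lemma golden_ratio_powi_recurrence:
  assumes "j = i + 1" "k = i + 2"
  shows "golden_ratio powi k = golden_ratio powi j + golden_ratio powi i"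
  using golden_ratio_powi_add [of i] assms by simp

lemma lucas_eq_golden_ratio:
  "real (lucas n) = golden_ratio powi int n + (- 1) ^ n * golden_ratio powi (- int n)"
proof (induction n rule: lucas.induct)
  case 2
  show ?case
    using golden_ratio_pos golden_ratio_square
    by (simp add: power_int_minus field_simps)
next
  case (3 n)
  have "golden_ratio powi (- int n) =
      golden_ratio powi (- int n - 1) + golden_ratio powi (- int n - 2)"
    by (rule golden_ratio_powi_recurrence) simp_all
  moreover have "golden_ratio powi (int n + 2) = golden_ratio powi (int n + 1) + golden_ratio powi int n"
    by (rule golden_ratio_powi_recurrence) simp_all
  moreover have "int (Suc n) = int n + 1" "- int (Suc n) = - int n - 1"
    "int (Suc (Suc n)) = int n + 2" "- int (Suc (Suc n)) = - int n - 2"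
    by simp_all
  ultimately show ?case
    using 3 by (simp only: lucas.simps(3) of_nat_add power_Suc) (simp add: distrib_left)
qed simp

corollary lucas_even_eq_golden_ratio:
  assumes "even n" "i = int n" "j = - int n"
  shows "real (lucas n) = golden_ratio powi i + golden_ratio powi j"
  using lucas_eq_golden_ratio [of n] assms by simp

corollary lucas_odd_eq_golden_ratio:
  assumes "odd n" "i = int n" "j = - int n"
  shows "real (lucas n) = golden_ratio powi i - golden_ratio powi j"
  using lucas_eq_golden_ratio [of n] assms by simp

lemma lucas_strict_mono: "lucas (n + 1) < lucas (n + 2)"
  using lucas_eq_fib [of n] lucas_eq_fib [of "n + 1"] fib_neq_0_nat [of "n + 1"]
    fib_mono [of n "Suc n"] by simp

lemma lucas_ge: "n \<le> lucas n"
proof (induction n rule: lucas.induct)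
  case (3 n)
  moreover have "0 < lucas n" by (cases n) (auto simp: lucas_eq_fib fib_neq_0_nat)
  ultimately show ?case by (simp add: lucas.simps(3))
qed auto

text \<open>A ladder has \<open>a\<close> rungs, with indices in steps of two from \<open>b\<close> on.\<close>

definition lucas_ladder :: "nat \<Rightarrow> nat \<Rightarrow> nat" where
  "lucas_ladder b a = (\<Sum>i<a. lucas (b + 2 * i))"

lemma lucas_ladder_Suc: "lucas_ladder b (Suc a) = lucas_ladder b a + lucas (b + 2 * a)"
  by (simp add: lucas_ladder_def)

text \<open>
  The first two rungs add up to three Fibonacci numbers, since the two copies of \<open>F (b+2)\<close> in
  \<open>L (b+1) + L (b+3) = (F (b+2) + F b) + (F (b+4) + F (b+2))\<close> equal \<open>F (b+3) + F b\<close>, and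
  \<open>F (b+3) + F (b+4) = F (b+5)\<close>. From then on, if \<open>L k\<close> is the new rung, the leading summand is \<open>F k\<close>
  and \<open>F k + L k = F k + F (k+1) + F (k-1) = F (k+2) + F (k-1)\<close>: a further rung costs a single
  summand. The leading summand has to be kept separate from the rest \<open>Y\<close> for this step.
\<close>

lemma lucas_ladder_fib:
  "\<exists>Y. lucas_ladder (Suc b) (a + 2) = fib (b + 2 * a + 5) + Y \<and> zeckendorf_digit_sum Y \<le> a + 2"
proof (induction a)
  case 0
  have "lucas_ladder (Suc b) 2 = fib (b + 5) + (fib b + fib b)"
    by (simp add: lucas_ladder_def numeral_2_eq_2 lucas_eq_fib) (simp add: numeral_eq_Suc)
  moreover have "zeckendorf_digit_sum (fib b + fib b) \<le> 2"
    using zeckendorf_digit_sum_add_le [of "fib b" "fib b"] zeckendorf_digit_sum_fib [of b] by simp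
  ultimately show ?case by (intro exI [of _ "fib b + fib b"]) (simp add: numeral_2_eq_2)
next
  case (Suc a)
  then obtain Y where Y: "lucas_ladder (Suc b) (a + 2) = fib (b + 2 * a + 5) + Y"
    "zeckendorf_digit_sum Y \<le> a + 2" by blast
  have "lucas_ladder (Suc b) (Suc a + 2) =
      lucas_ladder (Suc b) (a + 2) + lucas (Suc (b + 2 * a + 4))"
    using lucas_ladder_Suc [of "Suc b" "a + 2"] by (simp add: numeral_eq_Suc)
  also have "\<dots> = fib (b + 2 * Suc a + 5) + (fib (b + 2 * a + 4) + Y)"
    unfolding Y lucas_eq_fib by (simp add: numeral_eq_Suc)
  finally show ?case
    using Y(2) zeckendorf_digit_sum_fib [of "b + 2 * a + 4"]
      zeckendorf_digit_sum_add_le [of "fib (b + 2 * a + 4)" Y] by (intro exI) auto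
qed

lemma zeckendorf_digit_sum_lucas_ladder:
  "zeckendorf_digit_sum (lucas_ladder (Suc b) a) \<le> a + 1"
proof -
  consider "a = 0" | "a = 1" | c where "a = c + 2"
    by (metis One_nat_def add_2_eq_Suc' not0_implies_Suc)
  thus ?thesis
  proof cases
    case 1
    thus ?thesis by (simp add: lucas_ladder_def zeckendorf_digit_sum_0)
  next
    case 2
    thus ?thesis using zeckendorf_digit_sum_lucas [of b] by (simp add: lucas_ladder_def)
  next
    case 3
    obtain Y where "lucas_ladder (Suc b) a = fib (b + 2 * c + 5) + Y"
      "zeckendorf_digit_sum Y \<le> c + 2"
      using lucas_ladder_fib [of b c] 3 by blast
    thus ?thesis
      using zeckendorf_digit_sum_add_le [of "fib (b + 2 * c + 5)" Y]
        zeckendorf_digit_sum_fib [of "b + 2 * c + 5"] 3 by simp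
  qed
qed

section \<open>Passing from one Lucas interval to the next\<close>

definition phi_expansion :: "int set \<Rightarrow> nat \<Rightarrow> bool" where
  "phi_expansion S N \<longleftrightarrow> finite S \<and> (\<forall>i\<in>S. i + 1 \<notin> S) \<and>
    (\<Sum>i\<in>S. golden_ratio powi i) = real N"

lemma phi_expansion_digit_sum:
  assumes "phi_expansion S n"
  shows "base_phi_digit_sum n = card S"
proof -
  have "base_phi_rep n (\<lambda>i. of_bool (i \<in> S))"
    using assms by (auto simp: base_phi_rep_def phi_expansion_def)
  hence "base_phi_digit n = (\<lambda>i. of_bool (i \<in> S))"
    using base_phi_rep_ex1 base_phi_rep_digit by blast
  thus ?thesis by (simp add: base_phi_digit_sum_def)
qed

text \<open>
  The recursive steps all exchange a few digits \<open>A\<close> for a few digits \<open>B\<close>. The cardinality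
  equation avoids truncated subtraction.
\<close>

lemma phi_expansion_replace:
  assumes "phi_expansion S N" "A \<subseteq> S" "finite B" "B \<inter> (S - A) = {}"
    and "\<And>i. i \<in> (S - A) \<union> B \<Longrightarrow> i + 1 \<notin> (S - A) \<union> B"
    and "(\<Sum>i\<in>B. golden_ratio powi i) = (\<Sum>i\<in>A. golden_ratio powi i) + real M"
  shows "phi_expansion ((S - A) \<union> B) (N + M) \<and> card ((S - A) \<union> B) + card A = card S + card B"
proof -
  have fin: "finite S" "finite A" using assms(1,2) by (auto simp: phi_expansion_def intro: finite_subset)
  have "(\<Sum>i\<in>(S - A) \<union> B. golden_ratio powi i) =
      (\<Sum>i\<in>S - A. golden_ratio powi i) + (\<Sum>i\<in>B. golden_ratio powi i)"
    using assms(3,4) fin by (intro sum.union_disjoint) auto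
  also have "(\<Sum>i\<in>S - A. golden_ratio powi i) = real N - (\<Sum>i\<in>A. golden_ratio powi i)"
    using assms(1,2) fin by (simp add: sum_diff phi_expansion_def)
  finally have "(\<Sum>i\<in>(S - A) \<union> B. golden_ratio powi i) = real (N + M)"
    using assms(6) by simp
  hence "phi_expansion ((S - A) \<union> B) (N + M)"
    using assms(3,5) fin unfolding phi_expansion_def by blast
  moreover have "card ((S - A) \<union> B) = card (S - A) + card B"
    using assms(3,4) fin by (intro card_Un_disjoint) auto
  hence "card ((S - A) \<union> B) + card A = card S + card B"
    using assms(2) fin card_mono [of S A] by (simp add: card_Diff_subset)
  ultimately show ?thesis ..
qed

text \<open>\<open>L (2n+2) = \<phi>^(2n+2) + \<phi>^(-2n-2)\<close>, and both positions lie beyond the two ends of \<open>S\<close>.\<close>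

lemma phi_expansion_add_even_lucas:
  assumes "phi_expansion S N" "S \<subseteq> {- 2 * int n..2 * int n}"
  defines "T \<equiv> S \<union> {2 * int n + 2, - 2 * int n - 2}"
  shows "phi_expansion T (N + lucas (2 * n + 2)) \<and> card T = card S + 2"
proof -
  let ?B = "{2 * int n + 2, - 2 * int n - 2}"
  have bounds: "- 2 * int n \<le> i \<and> i \<le> 2 * int n" if "i \<in> S" for i
    using assms(2) that by auto
  have gap: "i + 1 \<notin> S" if "i \<in> S" for i
    using assms(1) that by (simp add: phi_expansion_def)
  have "phi_expansion ((S - {}) \<union> ?B) (N + lucas (2 * n + 2)) \<and>
      card ((S - {}) \<union> ?B) + card ({} :: int set) = card S + card ?B"
  proof (rule phi_expansion_replace)
    show "?B \<inter> (S - {}) = {}"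
      using bounds [of "2 * int n + 2"] bounds [of "- 2 * int n - 2"] by auto
    show "i + 1 \<notin> (S - {}) \<union> ?B" if "i \<in> (S - {}) \<union> ?B" for i
      using that gap [of i] bounds [of i] bounds [of "i + 1"] by auto
    show "(\<Sum>i\<in>?B. golden_ratio powi i) =
        (\<Sum>i\<in>{}. golden_ratio powi i) + real (lucas (2 * n + 2))"
      using lucas_even_eq_golden_ratio [of "2 * n + 2" "2 * int n + 2" "- 2 * int n - 2"] by simp
  qed (use assms(1) in auto)
  thus ?thesis by (simp add: T_def)
qed

text \<open>
  This is the shape of the expansions of the numbers strictly between \<open>L (2n+1)\<close> and \<open>L (2n+2)\<close>: they
  start at position \<open>2n+1\<close> and end with the digits 001 at positions \<open>-2n\<close>, \<open>-2n-1\<close>, \<open>-2n-2\<close>. Position \<open>-2n\<close>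
  must be free because \<open>odd_phi_expansion_shift_top\<close> places a digit at its neighbour \<open>-2n-1\<close>.
\<close>

definition odd_phi_expansion :: "nat \<Rightarrow> int set \<Rightarrow> nat \<Rightarrow> bool" where
  "odd_phi_expansion n S N \<longleftrightarrow> phi_expansion S N \<and> S \<subseteq> {- 2 * int n - 2..2 * int n + 1} \<and>
    2 * int n + 1 \<in> S \<and> - 2 * int n - 2 \<in> S \<and> - 2 * int n \<notin> S"

text \<open>
  Adding \<open>\<phi>^(2n+2)\<close> moves the top digit from \<open>2n+1\<close> to \<open>2n+3\<close>. Adding \<open>\<phi>^(-2n-2)\<close> doubles the last digit, and
  \<open>2 \<phi>^i = \<phi>^(i+1) + \<phi>^(i-2)\<close>.
\<close>

lemma odd_phi_expansion_shift_top:
  assumes "odd_phi_expansion n S N"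
  shows "\<exists>T. odd_phi_expansion (n + 1) T (N + lucas (2 * n + 2)) \<and> card T = card S + 1"
proof -
  let ?A = "{2 * int n + 1, - 2 * int n - 2}"
  let ?B = "{2 * int n + 3, - 2 * int n - 1, - 2 * int n - 4}"
  have S: "phi_expansion S N" and ends: "2 * int n + 1 \<in> S" "- 2 * int n - 2 \<in> S" "- 2 * int n \<notin> S"
    using assms by (auto simp: odd_phi_expansion_def)
  have bounds: "- 2 * int n - 2 \<le> i \<and> i \<le> 2 * int n + 1" if "i \<in> S" for i
    using assms that by (auto simp: odd_phi_expansion_def)
  have gap: "i + 1 \<notin> S" if "i \<in> S" for i
    using S that by (simp add: phi_expansion_def)
  have "- 2 * int n - 1 = (- 2 * int n - 2) + 1" by simp
  hence low: "- 2 * int n - 1 \<notin> S"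
    using gap [OF ends(2)] by presburger
  have powers: "real (lucas (2 * n + 2)) = golden_ratio powi (2 * int n + 2) + golden_ratio powi (- 2 * int n - 2)"
    "golden_ratio powi (2 * int n + 3) = golden_ratio powi (2 * int n + 2) + golden_ratio powi (2 * int n + 1)"
    "golden_ratio powi (- 2 * int n - 2) = golden_ratio powi (- 2 * int n - 3) + golden_ratio powi (- 2 * int n - 4)"
    "golden_ratio powi (- 2 * int n - 1) = golden_ratio powi (- 2 * int n - 2) + golden_ratio powi (- 2 * int n - 3)"
    by (rule lucas_even_eq_golden_ratio golden_ratio_powi_recurrence; simp)+
  have "phi_expansion ((S - ?A) \<union> ?B) (N + lucas (2 * n + 2)) \<and>
      card ((S - ?A) \<union> ?B) + card ?A = card S + card ?B"
  proof (rule phi_expansion_replace [OF S])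
    show "?A \<subseteq> S" using ends by simp
    show "?B \<inter> (S - ?A) = {}"
      using low bounds [of "2 * int n + 3"] bounds [of "- 2 * int n - 4"] by auto
    show "i + 1 \<notin> (S - ?A) \<union> ?B" if i: "i \<in> (S - ?A) \<union> ?B" for i
    proof
      assume j: "i + 1 \<in> (S - ?A) \<union> ?B"
      show False
        using i j ends gap [of i] bounds [of i] bounds [of "i + 1"]
        by (elim UnE DiffE insertE emptyE) auto
    qed
    show "(\<Sum>i\<in>?B. golden_ratio powi i) =
        (\<Sum>i\<in>?A. golden_ratio powi i) + real (lucas (2 * n + 2))"
      using powers by simp
  qed simp
  thus ?thesis
    using ends low
    by (intro exI [of _ "(S - ?A) \<union> ?B"]) (auto simp: odd_phi_expansion_def dest: bounds)
qed

text \<open>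
  Here \<open>L (2n+3) = \<phi>^(2n+3) - \<phi>^(-2n-3)\<close>. The first term is a new top digit; the subtraction moves the last
  digit from \<open>-2n-2\<close> to \<open>-2n-4\<close>, because \<open>\<phi>^(-2n-2) = \<phi>^(-2n-3) + \<phi>^(-2n-4)\<close>.
\<close>

lemma odd_phi_expansion_new_top:
  assumes "odd_phi_expansion n S N"
  shows "\<exists>T. odd_phi_expansion (n + 1) T (N + lucas (2 * n + 3)) \<and> card T = card S + 1"
proof -
  let ?A = "{- 2 * int n - 2}"
  let ?B = "{2 * int n + 3, - 2 * int n - 4}"
  have S: "phi_expansion S N" and ends: "2 * int n + 1 \<in> S" "- 2 * int n - 2 \<in> S" "- 2 * int n \<notin> S"
    using assms by (auto simp: odd_phi_expansion_def)
  have bounds: "- 2 * int n - 2 \<le> i \<and> i \<le> 2 * int n + 1" if "i \<in> S" for i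
    using assms that by (auto simp: odd_phi_expansion_def)
  have gap: "i + 1 \<notin> S" if "i \<in> S" for i
    using S that by (simp add: phi_expansion_def)
  have "- 2 * int n - 1 = (- 2 * int n - 2) + 1" by simp
  hence low: "- 2 * int n - 1 \<notin> S"
    using gap [OF ends(2)] by presburger
  have powers: "real (lucas (2 * n + 3)) = golden_ratio powi (2 * int n + 3) - golden_ratio powi (- 2 * int n - 3)"
    "golden_ratio powi (- 2 * int n - 2) = golden_ratio powi (- 2 * int n - 3) + golden_ratio powi (- 2 * int n - 4)"
    by (rule lucas_odd_eq_golden_ratio golden_ratio_powi_recurrence; simp)+
  have "phi_expansion ((S - ?A) \<union> ?B) (N + lucas (2 * n + 3)) \<and>
      card ((S - ?A) \<union> ?B) + card ?A = card S + card ?B"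
  proof (rule phi_expansion_replace [OF S])
    show "?A \<subseteq> S" using ends by simp
    show "?B \<inter> (S - ?A) = {}"
      using low bounds [of "2 * int n + 3"] bounds [of "- 2 * int n - 4"] by auto
    show "i + 1 \<notin> (S - ?A) \<union> ?B" if i: "i \<in> (S - ?A) \<union> ?B" for i
    proof
      assume j: "i + 1 \<in> (S - ?A) \<union> ?B"
      show False
        using i j ends gap [of i] bounds [of i] bounds [of "i + 1"]
        by (elim UnE DiffE insertE emptyE) auto
    qed
    show "(\<Sum>i\<in>?B. golden_ratio powi i) =
        (\<Sum>i\<in>?A. golden_ratio powi i) + real (lucas (2 * n + 3))"
      using powers by simp
  qed simp
  thus ?thesis
    using ends low
    by (intro exI [of _ "(S - ?A) \<union> ?B"]) (auto simp: odd_phi_expansion_def dest: bounds)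
qed

text \<open>
  Again \<open>\<phi>^(2n+3)\<close> is a new top digit, but now the last digit sits at \<open>-2n\<close>. To make \<open>\<phi>^(-2n-3)\<close> available for
  subtraction it has to be expanded twice:
  \<open>\<phi>^(-2n) = \<phi>^(-2n-1) + \<phi>^(-2n-2) = \<phi>^(-2n-1) + \<phi>^(-2n-3) + \<phi>^(-2n-4)\<close>.
\<close>

lemma odd_phi_expansion_from_even:
  assumes "phi_expansion S N" "S \<subseteq> {- 2 * int n..2 * int n}" "- 2 * int n \<in> S"
  shows "\<exists>T. odd_phi_expansion (n + 1) T (N + lucas (2 * n + 3)) \<and> card T = card S + 2"
proof -
  let ?A = "{- 2 * int n}"
  let ?B = "{2 * int n + 3, - 2 * int n - 1, - 2 * int n - 4}"
  have S: "phi_expansion S N" and ends: "- 2 * int n \<in> S"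
    using assms by auto
  have bounds: "- 2 * int n \<le> i \<and> i \<le> 2 * int n" if "i \<in> S" for i
    using assms that by auto
  have gap: "i + 1 \<notin> S" if "i \<in> S" for i
    using S that by (simp add: phi_expansion_def)
  have low: "- 2 * int n - 1 \<notin> S"
    using bounds [of "- 2 * int n - 1"] by auto
  have powers: "real (lucas (2 * n + 3)) = golden_ratio powi (2 * int n + 3) - golden_ratio powi (- 2 * int n - 3)"
    "golden_ratio powi (- 2 * int n) = golden_ratio powi (- 2 * int n - 1) + golden_ratio powi (- 2 * int n - 2)"
    "golden_ratio powi (- 2 * int n - 2) = golden_ratio powi (- 2 * int n - 3) + golden_ratio powi (- 2 * int n - 4)"
    by (rule lucas_odd_eq_golden_ratio golden_ratio_powi_recurrence; simp)+
  have "phi_expansion ((S - ?A) \<union> ?B) (N + lucas (2 * n + 3)) \<and>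
      card ((S - ?A) \<union> ?B) + card ?A = card S + card ?B"
  proof (rule phi_expansion_replace [OF S])
    show "?A \<subseteq> S" using ends by simp
    show "?B \<inter> (S - ?A) = {}"
      using low bounds [of "2 * int n + 3"] bounds [of "- 2 * int n - 4"] by auto
    show "i + 1 \<notin> (S - ?A) \<union> ?B" if i: "i \<in> (S - ?A) \<union> ?B" for i
    proof
      assume j: "i + 1 \<in> (S - ?A) \<union> ?B"
      show False
        using i j ends gap [of i] bounds [of i] bounds [of "i + 1"]
        by (elim UnE DiffE insertE emptyE) auto
    qed
    show "(\<Sum>i\<in>?B. golden_ratio powi i) =
        (\<Sum>i\<in>?A. golden_ratio powi i) + real (lucas (2 * n + 3))"
      using powers by simp
  qed simp
  thus ?thesis
    using ends low
    by (intro exI [of _ "(S - ?A) \<union> ?B"]) (auto simp: odd_phi_expansion_def dest: bounds)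
qed

section \<open>The induction over Lucas intervals\<close>

text \<open>
  The number \<open>c\<close> stands for the base-\<open>\<phi>\<close> digit sum of \<open>N\<close>. The \<open>a + 1\<close> rungs of the ladder, with top rung
  \<open>L (2n+1)\<close>, are charged at \<open>a + 2\<close>, their cost as Fibonacci summands.
\<close>

definition ladder_bound :: "nat \<Rightarrow> nat \<Rightarrow> nat \<Rightarrow> bool" where
  "ladder_bound n N c \<longleftrightarrow> (\<exists>b a X. Suc b + 2 * a = 2 * n + 1 \<and>
     N = lucas_ladder (Suc b) (a + 1) + X \<and> a + 2 + zeckendorf_digit_sum X \<le> c)"

lemma ladder_bound_imp_digit_sum:
  assumes "ladder_bound n N c"
  shows "zeckendorf_digit_sum N \<le> c"
proof -
  obtain b a X where "N = lucas_ladder (Suc b) (a + 1) + X" "a + 2 + zeckendorf_digit_sum X \<le> c"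
    using assms unfolding ladder_bound_def by blast
  thus ?thesis
    using zeckendorf_digit_sum_lucas_ladder [of b "a + 1"]
      zeckendorf_digit_sum_add_le [of "lucas_ladder (Suc b) (a + 1)" X] by simp
qed

lemma ladder_bound_base: "ladder_bound n (lucas (2 * n + 1) + X) (2 + zeckendorf_digit_sum X)"
  unfolding ladder_bound_def
  by (intro exI [of _ "2 * n"] exI [of _ 0] exI [of _ X]) (simp add: lucas_ladder_def)

lemma ladder_bound_mono: "ladder_bound n N c \<Longrightarrow> c \<le> d \<Longrightarrow> ladder_bound n N d"
  unfolding ladder_bound_def using le_trans by blast

text \<open>\<open>L (2n+3)\<close> is the next rung of a ladder with top rung \<open>L (2n+1)\<close>.\<close>

lemma ladder_bound_new_top:
  assumes "ladder_bound n N c"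
  shows "ladder_bound (n + 1) (N + lucas (2 * n + 3)) (c + 1)"
proof -
  obtain b a X where *: "Suc b + 2 * a = 2 * n + 1" "N = lucas_ladder (Suc b) (a + 1) + X"
    "a + 2 + zeckendorf_digit_sum X \<le> c"
    using assms unfolding ladder_bound_def by blast
  have "lucas_ladder (Suc b) (a + 2) = lucas_ladder (Suc b) (a + 1) + lucas (Suc b + 2 * (a + 1))"
    by (simp add: lucas_ladder_def)
  also have "Suc b + 2 * (a + 1) = 2 * n + 3" using *(1) by simp
  finally show ?thesis
    unfolding ladder_bound_def using * by (intro exI [of _ b] exI [of _ "a + 1"] exI [of _ X]) simp
qed

text \<open>
  The identity \<open>L (2n+1) + L (2n+2) = L (2n+3)\<close> turns the top rung into a new one-rung ladder, charged at 2
  instead of \<open>a + 2\<close>. The \<open>a\<close> lower rungs join the rest and raise its digit sum by at most \<open>a + 1\<close>. So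
  the total rises by at most 1.
\<close>

lemma ladder_bound_shift_top:
  assumes "ladder_bound n N c"
  shows "ladder_bound (n + 1) (N + lucas (2 * n + 2)) (c + 1)"
proof -
  obtain b a X where *: "Suc b + 2 * a = 2 * n + 1" "N = lucas_ladder (Suc b) (a + 1) + X"
    "a + 2 + zeckendorf_digit_sum X \<le> c"
    using assms unfolding ladder_bound_def by blast
  let ?Y = "lucas_ladder (Suc b) a + X"
  have "N = lucas_ladder (Suc b) a + lucas (2 * n + 1) + X"
    using *(2) unfolding *(1) [symmetric] by (simp add: lucas_ladder_def)
  hence "N + lucas (2 * n + 2) = lucas (2 * (n + 1) + 1) + ?Y"
    by (simp add: lucas.simps(3))
  moreover have "2 + zeckendorf_digit_sum ?Y \<le> c + 1"
    using *(3) zeckendorf_digit_sum_lucas_ladder [of b a]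
      zeckendorf_digit_sum_add_le [of "lucas_ladder (Suc b) a" X] by linarith
  ultimately show ?thesis
    using ladder_bound_base [of "n + 1" ?Y] ladder_bound_mono by presburger
qed

text \<open>
  All \<open>N\<close> up to \<open>L (2n+1)\<close> are included, not only those from \<open>L (2n)\<close> on: the step that adds \<open>L (2n+2)\<close> starts from
  any of them.
\<close>

definition even_range :: "nat \<Rightarrow> bool" where
  "even_range n \<longleftrightarrow> (\<forall>N\<le>lucas (2 * n + 1). \<exists>S. phi_expansion S N \<and>
     S \<subseteq> {- 2 * int n..2 * int n} \<and> (lucas (2 * n) \<le> N \<longrightarrow> - 2 * int n \<in> S) \<and>
     zeckendorf_digit_sum N \<le> card S)"

definition odd_range :: "nat \<Rightarrow> bool" where
  "odd_range n \<longleftrightarrow> (\<forall>N. lucas (2 * n + 1) < N \<longrightarrow> N < lucas (2 * n + 2) \<longrightarrow>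
     (\<exists>S. odd_phi_expansion n S N \<and> ladder_bound n N (card S)))"

lemma odd_phi_expansion_2: "odd_phi_expansion 0 {1, - 2} 2"
  using golden_ratio_powi_double [of 0]
  by (auto simp: odd_phi_expansion_def phi_expansion_def)

text \<open>
  The induction has to start at 1, as \<open>odd_range 0\<close> is false: its only number \<open>2 = L 1 + 1\<close> has two digits in
  base \<open>\<phi>\<close>, whereas the ladder and the rest cost \<open>2 + 1\<close>. The two numbers 5 and 6 between \<open>L 3\<close> and
  \<open>L 4\<close> do arise from the expansion of 2 by the general steps.
\<close>

lemma odd_range_1: "odd_range 1"
  unfolding odd_range_def
proof (intro allI impI)
  fix N assume N: "lucas (2 * 1 + 1) < N" "N < lucas (2 * 1 + 2)"
  have lucas: "lucas (2 * 0 + 2) = 3" "lucas (2 * 0 + 3) = 4" "lucas (2 * 1 + 1) = 4"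
    "lucas (2 * 1 + 2) = 7"
    by (simp_all add: numeral_eq_Suc lucas.simps(3))
  have "N = 5 \<or> N = 6" using N unfolding lucas by linarith
  moreover have "zeckendorf_digit_sum 1 \<le> 1" "zeckendorf_digit_sum 2 \<le> 1"
    using zeckendorf_digit_sum_fib [of 1] zeckendorf_digit_sum_fib [of 3]
    by (simp_all add: numeral_eq_Suc)
  hence "ladder_bound 1 5 3" "ladder_bound 1 6 3"
    using ladder_bound_base [of 1 1] ladder_bound_base [of 1 2] unfolding lucas
    by (auto elim!: ladder_bound_mono)
  moreover have "\<exists>S. odd_phi_expansion 1 S 5 \<and> card S = 3" "\<exists>S. odd_phi_expansion 1 S 6 \<and> card S = 3"
    using odd_phi_expansion_shift_top [OF odd_phi_expansion_2]
      odd_phi_expansion_new_top [OF odd_phi_expansion_2] unfolding lucas by (simp_all add: numeral_eq_Suc)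
  ultimately show "\<exists>S. odd_phi_expansion 1 S N \<and> ladder_bound 1 N (card S)"
    by metis
qed

text \<open>
  The images of the three steps exactly cover the numbers between \<open>L (2n+3)\<close> and \<open>L (2n+4)\<close>. Adding \<open>L (2n+2)\<close> to
  the previous odd interval reaches up to \<open>2 L (2n+2) = L (2n) + L (2n+3)\<close>; there adding \<open>L (2n+3)\<close> to the interval
  from \<open>L (2n)\<close> to \<open>L (2n+1)\<close> takes over, and after that adding it to the previous odd interval.
\<close>

lemma odd_range_Suc:
  assumes "even_range n" "odd_range n"
  shows "odd_range (n + 1)"
  unfolding odd_range_def
proof (intro allI impI)
  fix N assume N: "lucas (2 * (n + 1) + 1) < N" "N < lucas (2 * (n + 1) + 2)"
  let ?goal = "\<exists>S. odd_phi_expansion (n + 1) S N \<and> ladder_bound (n + 1) N (card S)"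
  have rec: "lucas (2 * (n + 1) + 2) = lucas (2 * n + 3) + lucas (2 * n + 2)"
    "lucas (2 * n + 3) = lucas (2 * n + 2) + lucas (2 * n + 1)"
    "lucas (2 * n + 2) = lucas (2 * n + 1) + lucas (2 * n)"
    "2 * (n + 1) + 1 = 2 * n + 3"
    by (simp_all add: numeral_eq_Suc lucas.simps(3))
  consider (low) "N < lucas (2 * n + 2) + lucas (2 * n + 2)"
    | (mid) "lucas (2 * n) + lucas (2 * n + 3) \<le> N" "N \<le> lucas (2 * n + 1) + lucas (2 * n + 3)"
    | (high) "lucas (2 * n + 1) + lucas (2 * n + 3) < N"
    using rec by linarith
  thus ?goal
  proof cases
    case low
    define K where "K = N - lucas (2 * n + 2)"
    have K: "N = K + lucas (2 * n + 2)" "lucas (2 * n + 1) < K" "K < lucas (2 * n + 2)"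
      using low N unfolding rec K_def by auto
    then obtain S where "odd_phi_expansion n S K" "ladder_bound n K (card S)"
      using assms(2) unfolding odd_range_def by blast
    thus ?thesis
      using odd_phi_expansion_shift_top ladder_bound_shift_top K(1) by metis
  next
    case mid
    define K where "K = N - lucas (2 * n + 3)"
    have K: "N = K + lucas (2 * n + 3)" "lucas (2 * n) \<le> K" "K \<le> lucas (2 * n + 1)"
      using mid N unfolding rec K_def by auto
    then obtain S where S: "phi_expansion S K" "S \<subseteq> {- 2 * int n..2 * int n}" "- 2 * int n \<in> S"
      "zeckendorf_digit_sum K \<le> card S"
      using assms(1) unfolding even_range_def by blast
    obtain T where T: "odd_phi_expansion (n + 1) T N" "card T = card S + 2"
      using odd_phi_expansion_from_even [OF S(1-3)] K(1) by metis
    \<comment> \<open>A one-rung ladder with rest \<open>K\<close>: the two new digits pay for its rung \<open>L (2n+3)\<close>.\<close>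
    have "ladder_bound (n + 1) N (card T)"
      using ladder_bound_base [of "n + 1" K] S(4) T(2) K(1) unfolding rec
      by (auto elim!: ladder_bound_mono simp: add.commute)
    thus ?thesis using T(1) by blast
  next
    case high
    define K where "K = N - lucas (2 * n + 3)"
    have K: "N = K + lucas (2 * n + 3)" "lucas (2 * n + 1) < K" "K < lucas (2 * n + 2)"
      using high N unfolding rec K_def by auto
    then obtain S where "odd_phi_expansion n S K" "ladder_bound n K (card S)"
      using assms(2) unfolding odd_range_def by blast
    thus ?thesis
      using odd_phi_expansion_new_top ladder_bound_new_top K(1) by metis
  qed
qed

lemma even_range_0: "even_range 0"
  unfolding even_range_def
proof (intro allI impI)
  fix N assume "N \<le> lucas (2 * 0 + 1)"
  hence "N = 0 \<or> N = 1" by auto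
  moreover have "phi_expansion {} 0" "phi_expansion {0} 1"
    by (simp_all add: phi_expansion_def)
  moreover have "zeckendorf_digit_sum 1 \<le> 1"
    using zeckendorf_digit_sum_fib [of 1] by simp
  ultimately show "\<exists>S. phi_expansion S N \<and> S \<subseteq> {- 2 * int 0..2 * int 0} \<and>
      (lucas (2 * 0) \<le> N \<longrightarrow> - 2 * int 0 \<in> S) \<and> zeckendorf_digit_sum N \<le> card S"
    by (elim disjE; intro exI [of _ "if N = 0 then {} else {0}"]) (auto simp: zeckendorf_digit_sum_0)
qed

text \<open>
  The assumption on the gap only asks for the digit sum inequality, not for \<open>odd_range n\<close>, so that the step is
  also usable at \<open>n = 0\<close>.
\<close>

lemma even_range_Suc:
  assumes "even_range n"
    and gap: "\<And>N. lucas (2 * n + 1) < N \<Longrightarrow> N < lucas (2 * n + 2) \<Longrightarrow>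
      \<exists>S. odd_phi_expansion n S N \<and> zeckendorf_digit_sum N \<le> card S"
  shows "even_range (n + 1)"
  unfolding even_range_def
proof (intro allI impI)
  fix N assume N: "N \<le> lucas (2 * (n + 1) + 1)"
  let ?goal = "\<exists>S. phi_expansion S N \<and> S \<subseteq> {- 2 * int (n + 1)..2 * int (n + 1)} \<and>
      (lucas (2 * (n + 1)) \<le> N \<longrightarrow> - 2 * int (n + 1) \<in> S) \<and> zeckendorf_digit_sum N \<le> card S"
  consider "N \<le> lucas (2 * n + 1)" | "lucas (2 * n + 1) < N" "N < lucas (2 * n + 2)"
    | "lucas (2 * n + 2) \<le> N" by linarith
  thus ?goal
  proof cases
    case 1
    then obtain S where "phi_expansion S N" "S \<subseteq> {- 2 * int n..2 * int n}"
      "zeckendorf_digit_sum N \<le> card S"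
      using assms(1) unfolding even_range_def by blast
    moreover have "N < lucas (2 * (n + 1))"
      using 1 lucas_strict_mono [of "2 * n"] by simp
    ultimately show ?thesis by (intro exI [of _ S]) (auto simp: subset_iff)
  next
    case 2
    then obtain S where "odd_phi_expansion n S N" "zeckendorf_digit_sum N \<le> card S"
      using gap by blast
    thus ?thesis using 2 by (intro exI [of _ S]) (auto simp: odd_phi_expansion_def subset_iff)
  next
    case 3
    define K where "K = N - lucas (2 * n + 2)"
    have K: "N = K + lucas (2 * n + 2)" "K \<le> lucas (2 * n + 1)"
      using 3 N by (auto simp: K_def lucas.simps(3))
    then obtain S where S: "phi_expansion S K" "S \<subseteq> {- 2 * int n..2 * int n}"
      "zeckendorf_digit_sum K \<le> card S"
      using assms(1) unfolding even_range_def by blast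
    have "zeckendorf_digit_sum N \<le> card S + 2"
      using zeckendorf_digit_sum_add_le [of K "lucas (2 * n + 2)"] S(3) K(1)
        zeckendorf_digit_sum_lucas [of "2 * n + 1"] by simp
    thus ?thesis
      using phi_expansion_add_even_lucas [OF S(1,2)] K(1) S(2)
      by (intro exI [of _ "S \<union> {2 * int n + 2, - 2 * int n - 2}"]) (auto simp: subset_iff)
  qed
qed

lemma even_and_odd_range: "even_range (n + 1) \<and> odd_range (n + 1)"
proof (induction n)
  case 0
  have "even_range (0 + 1)"
  proof (rule even_range_Suc [OF even_range_0])
    fix N assume "lucas (2 * 0 + 1) < N" "N < lucas (2 * 0 + 2)"
    hence "N = 2" by (simp add: numeral_2_eq_2 lucas.simps(3))
    moreover have "zeckendorf_digit_sum 2 \<le> 1"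
      using zeckendorf_digit_sum_fib [of 3] by (simp add: numeral_eq_Suc)
    ultimately show "\<exists>S. odd_phi_expansion 0 S N \<and> zeckendorf_digit_sum N \<le> card S"
      using odd_phi_expansion_2 by (intro exI [of _ "{1, - 2}"]) auto
  qed
  thus ?case using odd_range_1 by simp
next
  case (Suc n)
  moreover have "even_range (Suc n + 1)"
    using even_range_Suc [of "Suc n"] Suc ladder_bound_imp_digit_sum
    unfolding odd_range_def by (metis Suc_eq_plus1)
  ultimately show ?case using odd_range_Suc [of "n + 1"] by simp
qed

theorem theorem3p1:
  fixes n :: nat
  shows "zeckendorf_digit_sum n \<le> base_phi_digit_sum n"
proof -
  have "n \<le> lucas (2 * (n + 1) + 1)"
    using lucas_ge [of "2 * (n + 1) + 1"] by (rule le_trans [rotated]) simp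
  then obtain S where "phi_expansion S n" "zeckendorf_digit_sum n \<le> card S"
    using even_and_odd_range [of n] unfolding even_range_def by blast
  thus ?thesis by (simp add: phi_expansion_digit_sum)
qed

end
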